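(* Let $D=(d_{ij})$ be an $n\times n$ Euclidean distance matrix of embedding dimension $r\le n-4$. If $D$ is in general position in $\mathbb{R}^r$, then every off-diagonal entry of $D$ is unyielding, and every two distinct off-diagonal entries of $D$ in the same column (row) are jointly unyielding; i.e., for all distinct indices $i,j,k\in\{1,\ldots,n\}$, the entries $d_{ij}$ and $d_{ik}$ are jointly unyielding.
   Context: An $n\times n$ real matrix $D=(d_{ij})$ is a Euclidean distance matrix (EDM) if there exist points $p^1,\ldots,p^n$ in some Euclidean space with $d_{ij}=\|p^i-p^j\|^2$ for all $i,j$; such points are generating points of $D$, and the dimension of their affine span is the embedding dimension $r$ of $D$ (the generating points can be taken in $\mathbb{R}^r$). For $i\ne j$, $E^{ij}$ is the $n\times n$ symmetric matrix with 1's in the $ij$th and $ji$th entries and 0's elsewhere. For an off-diagonal entry $d_{ij}$, let $[l_{ij},u_{ij}]$ (with $l_{ij}\le 0\le u_{ij}$) be the closed interval such that $D+tE^{ij}$ is an EDM if and only if $l_{ij}\le t\le u_{ij}$. The entry $d_{ij}$ is unyielding if $l_{ij}=u_{ij}=0$, and yielding otherwise. Two unyielding entries $d_{ij}$ and $d_{ik}$ ($i,j,k$ distinct) are jointly yielding if $D+t_1E^{ij}+t_2E^{ik}$ is an EDM for some nonzero scalars $t_1$ and $t_2$; otherwise they are jointly unyielding. Points $p^1,\ldots,p^n$ in $\mathbb{R}^r$ are in general position if every $r+1$ of them are affinely independent (as an indexed family). An EDM of embedding dimension $r$ is in general position if its generating points in $\mathbb{R}^r$ are in general position. *)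

theory Defs
  imports "HOL-Analysis.Analysis"
begin

definition generating_points :: "real ^ 'n ^ 'n \<Rightarrow> ('n::finite \<Rightarrow> 'a::euclidean_space) \<Rightarrow> bool" where
  "generating_points D p \<longleftrightarrow> (\<forall>i j. D $ i $ j = (norm (p i - p j))\<^sup>2)"

lemma norm_lincomb_generating_points:
  fixes p :: "'n::finite \<Rightarrow> 'a::euclidean_space" and c :: "'n \<Rightarrow> real"
  assumes D: "generating_points D p" and I: "finite I" and c: "sum c I = 0"
  shows "(norm (\<Sum>i\<in>I. c i *\<^sub>R p i))\<^sup>2 = - (\<Sum>i\<in>I. \<Sum>j\<in>I. c i * c j * D $ i $ j) / 2"
proof -
  have e: "c i * c j * D $ i $ j =
      c j * (c i * (p i \<bullet> p i)) + c i * (c j * (p j \<bullet> p j)) - 2 * ((c i *\<^sub>R p i) \<bullet> (c j *\<^sub>R p j))" for i j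
  proof -
    have "D $ i $ j = p i \<bullet> p i + p j \<bullet> p j - 2 * (p i \<bullet> p j)"
      using D by (simp add: generating_points_def power2_norm_eq_inner algebra_simps inner_commute)
    then show ?thesis by (simp only:) (simp add: algebra_simps)
  qed
  have "(\<Sum>i\<in>I. \<Sum>j\<in>I. c i * c j * D $ i $ j)
     = (\<Sum>i\<in>I. \<Sum>j\<in>I. c j * (c i * (p i \<bullet> p i))) + (\<Sum>i\<in>I. \<Sum>j\<in>I. c i * (c j * (p j \<bullet> p j)))
       - 2 * (\<Sum>i\<in>I. \<Sum>j\<in>I. (c i *\<^sub>R p i) \<bullet> (c j *\<^sub>R p j))"
    unfolding e sum.distrib sum_subtractf sum_distrib_left ..
  also have "(\<Sum>i\<in>I. \<Sum>j\<in>I. c j * (c i * (p i \<bullet> p i))) = 0"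
    unfolding sum_distrib_right[symmetric] c by simp
  also have "(\<Sum>i\<in>I. \<Sum>j\<in>I. c i * (c j * (p j \<bullet> p j))) = 0"
    unfolding sum_distrib_left[symmetric] sum_distrib_right[symmetric] c by simp
  also have "(\<Sum>i\<in>I. \<Sum>j\<in>I. (c i *\<^sub>R p i) \<bullet> (c j *\<^sub>R p j)) = (norm (\<Sum>i\<in>I. c i *\<^sub>R p i))\<^sup>2"
    unfolding power2_norm_eq_inner inner_sum_left inner_sum_right by (rule sum.swap)
  finally show ?thesis by simp
qed

definition affinely_independent_family :: "('i \<Rightarrow> 'a::euclidean_space) \<Rightarrow> 'i set \<Rightarrow> bool" where
  "affinely_independent_family p I \<longleftrightarrow> inj_on p I \<and> \<not> affine_dependent (p ` I)"

lemma affinely_independent_family_iff: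
  assumes I: "finite I"
  shows "affinely_independent_family p I \<longleftrightarrow>
    (\<forall>c. sum c I = 0 \<and> (\<Sum>i\<in>I. c i *\<^sub>R p i) = 0 \<longrightarrow> (\<forall>i\<in>I. c i = 0))" (is "?L \<longleftrightarrow> ?R")
proof
  assume L: ?L
  then have inj: "inj_on p I" and nd: "\<not> affine_dependent (p ` I)"
    by (auto simp: affinely_independent_family_def)
  show ?R
  proof (intro allI impI ballI)
    fix c i assume c: "sum c I = 0 \<and> (\<Sum>i\<in>I. c i *\<^sub>R p i) = 0" and i: "i \<in> I"
    define u where "u = c \<circ> the_inv_into I p"
    have u: "u (p j) = c j" if "j \<in> I" for j
      using the_inv_into_f_f[OF inj that] by (simp add: u_def)
    have "sum u (p ` I) = 0" "(\<Sum>v\<in>p ` I. u v *\<^sub>R v) = 0"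
      using c by (simp_all add: sum.reindex[OF inj] u)
    then have "u (p i) = 0"
      using nd i I by (auto simp: affine_dependent_explicit_finite)
    then show "c i = 0" using u i by simp
  qed
next
  assume R: ?R
  have inj: "inj_on p I"
  proof (rule inj_onI, rule ccontr)
    fix x y assume xy: "x \<in> I" "y \<in> I" "p x = p y" "x \<noteq> y"
    define c where "c = (\<lambda>i. (if i = x then 1 else 0) - (if i = y then 1 else (0::real)))"
    have "sum c I = 0" using xy I by (simp add: c_def sum_subtractf)
    moreover have "(\<Sum>i\<in>I. c i *\<^sub>R p i) = 0"
      using xy I by (simp add: c_def sum_subtractf scaleR_diff_left if_distrib[where f="\<lambda>t. t *\<^sub>R _"] cong: if_cong)
    ultimately have "c x = 0" using R xy by blast
    then show False using xy by (simp add: c_def)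
  qed
  moreover have "\<not> affine_dependent (p ` I)"
  proof
    assume "affine_dependent (p ` I)"
    then obtain u v where u: "sum u (p ` I) = 0" "v \<in> p ` I" "u v \<noteq> 0" "(\<Sum>v\<in>p ` I. u v *\<^sub>R v) = 0"
      using I by (auto simp: affine_dependent_explicit_finite)
    have "sum (u \<circ> p) I = 0" "(\<Sum>i\<in>I. (u \<circ> p) i *\<^sub>R p i) = 0"
      using u by (simp_all add: sum.reindex[OF inj])
    then have "\<forall>i\<in>I. (u \<circ> p) i = 0" using R by blast
    then show False using u by auto
  qed
  ultimately show ?L by (simp add: affinely_independent_family_def)
qed

lemma affinely_independent_family_generating_points:
  fixes p :: "'n::finite \<Rightarrow> 'a::euclidean_space" and q :: "'n \<Rightarrow> 'b::euclidean_space"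
  assumes "generating_points D p" "generating_points D q"
  shows "affinely_independent_family p I \<longleftrightarrow> affinely_independent_family q I"
proof -
  have "(\<Sum>i\<in>I. c i *\<^sub>R p i) = 0 \<longleftrightarrow> (\<Sum>i\<in>I. c i *\<^sub>R q i) = 0" if c: "sum c I = 0" for c
  proof -
    have "(norm (\<Sum>i\<in>I. c i *\<^sub>R p i))\<^sup>2 = (norm (\<Sum>i\<in>I. c i *\<^sub>R q i))\<^sup>2"
      using norm_lincomb_generating_points[OF assms(1) finite[of I] c]
        norm_lincomb_generating_points[OF assms(2) finite[of I] c] by (simp only:)
    then have "norm (\<Sum>i\<in>I. c i *\<^sub>R p i) = norm (\<Sum>i\<in>I. c i *\<^sub>R q i)"
      by (rule power2_eq_imp_eq) simp_all
    then show ?thesis by (metis norm_eq_zero)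
  qed
  then show ?thesis by (auto simp: affinely_independent_family_iff)
qed

lemma aff_dim_generating_points_le:
  fixes p :: "'n::finite \<Rightarrow> 'a::euclidean_space" and q :: "'n \<Rightarrow> 'b::euclidean_space"
  assumes "generating_points D p" "generating_points D q"
  shows "aff_dim (range p) \<le> aff_dim (range q)"
proof -
  obtain B where B: "B \<subseteq> range p" "\<not> affine_dependent B" "affine hull range p = affine hull B"
    using affine_basis_exists by blast
  obtain I where I: "inj_on p I" "B = p ` I"
    using B(1) by (metis subset_image_inj)
  have "affinely_independent_family q I"
    using I B(2) assms affinely_independent_family_generating_points
    by (metis affinely_independent_family_def)
  then have q: "inj_on q I" "\<not> affine_dependent (q ` I)"
    by (auto simp: affinely_independent_family_def)
  have "aff_dim (range p) = aff_dim B"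
    by (metis B(3) aff_dim_affine_hull)
  also have "\<dots> = int (card I) - 1"
    using B(2) I by (simp add: affine_independent_iff_card card_image)
  also have "\<dots> = aff_dim (q ` I)"
    using q by (simp add: affine_independent_iff_card card_image)
  also have "\<dots> \<le> aff_dim (range q)" by (intro aff_dim_subset) auto
  finally show ?thesis .
qed

lemma aff_dim_generating_points:
  fixes p :: "'n::finite \<Rightarrow> 'a::euclidean_space" and q :: "'n \<Rightarrow> 'b::euclidean_space"
  assumes "generating_points D p" "generating_points D q"
  shows "aff_dim (range p) = aff_dim (range q)"
  using aff_dim_generating_points_le[OF assms] aff_dim_generating_points_le[OF assms(2,1)]
  by (rule order_antisym)

text \<open>
  The affine span of \<open>n\<close> points has dimension at most \<open>n - 1\<close>, so nothing is lost by
  letting the points of an \<open>n\<close>-by-\<open>n\<close> EDM live in \<open>\<real>\<^sup>n\<close>: points in any Euclidean space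
  generate an EDM in this sense (\<open>EDM_if_generating_points\<close>).
\<close>

definition EDM :: "real ^ 'n ^ 'n \<Rightarrow> bool" where
  "EDM D \<longleftrightarrow> (\<exists>p :: 'n::finite \<Rightarrow> real ^ 'n. generating_points D p)"

lemma EDM_if_generating_points:
  fixes p :: "'n::finite \<Rightarrow> 'a::euclidean_space"
  assumes D: "generating_points D p"
  shows "EDM D"
proof -
  define a :: 'n where "a = undefined"
  define S where "S = span ((\<lambda>i. p i - p a) ` (UNIV - {a}))"
  have "dim S \<le> card ((\<lambda>i. p i - p a) ` (UNIV - {a}))"
    unfolding S_def dim_span by (rule dim_le_card') simp
  also have "\<dots> \<le> card (UNIV - {a})" by (rule card_image_le) simp
  also have "\<dots> \<le> CARD('n)" by (rule card_mono) auto
  finally have dim: "dim S \<le> dim (UNIV :: (real ^ 'n) set)" by simp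
  have S: "subspace S" by (simp add: S_def)
  obtain f :: "'a \<Rightarrow> real ^ 'n"
    where f: "linear f" "\<And>x. x \<in> S \<Longrightarrow> norm (f x) = norm x"
  proof (rule isometry_subset_subspace[OF S subspace_UNIV dim])
    fix f :: "'a \<Rightarrow> real ^ 'n"
    assume "linear f" "\<And>x. x \<in> S \<Longrightarrow> norm (f x) = norm x"
    then show thesis by (rule that)
  qed
  have mem: "p i - p a \<in> S" for i
    unfolding S_def by (cases "i = a") (simp_all add: span_base span_zero)
  have "norm (f (p i - p a) - f (p j - p a)) = norm (p i - p j)" for i j
  proof -
    have "(p i - p a) - (p j - p a) \<in> S"
      using S mem by (simp only: subspace_diff)
    then have "norm (f ((p i - p a) - (p j - p a))) = norm ((p i - p a) - (p j - p a))"
      by (rule f(2))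
    then show ?thesis unfolding linear_diff[OF f(1), of "p i - p a"] by simp
  qed
  then have "generating_points D (\<lambda>i. f (p i - p a))"
    using D by (simp add: generating_points_def)
  then show ?thesis by (auto simp: EDM_def)
qed

text \<open>
  Well defined, and independent of generating points and ambient space, by \<open>embedding_dim_eq\<close>.
\<close>

definition embedding_dim :: "real ^ 'n ^ 'n \<Rightarrow> nat" where
  "embedding_dim D =
     (THE r. \<exists>p :: 'n::finite \<Rightarrow> real ^ 'n. generating_points D p \<and> aff_dim (range p) = int r)"

lemma embedding_dim_eq:
  fixes p :: "'n::finite \<Rightarrow> 'a::euclidean_space"
  assumes D: "generating_points D p"
  shows "int (embedding_dim D) = aff_dim (range p)"
proof -
  obtain q :: "'n \<Rightarrow> real ^ 'n" where q: "generating_points D q"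
    using EDM_if_generating_points[OF D] by (auto simp: EDM_def)
  have eq: "aff_dim (range q') = aff_dim (range p)" if "generating_points D q'"
    for q' :: "'n \<Rightarrow> real ^ 'n"
    using aff_dim_generating_points[OF that D] .
  have "aff_dim (range p) \<noteq> -1" by (metis aff_dim_empty UNIV_not_empty image_is_empty)
  then have nn: "aff_dim (range p) \<ge> 0" using aff_dim_geq[of "range p"] by linarith
  have "embedding_dim D = nat (aff_dim (range p))"
    unfolding embedding_dim_def
  proof (rule the_equality)
    show "\<exists>p' :: 'n \<Rightarrow> real ^ 'n. generating_points D p' \<and> aff_dim (range p') = int (nat (aff_dim (range p)))"
      using q eq nn by auto
  qed (use eq in auto)
  then show ?thesis using nn by simp
qed

definition general_position :: "nat \<Rightarrow> ('n \<Rightarrow> 'a::euclidean_space) \<Rightarrow> bool" where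
  "general_position r p \<longleftrightarrow> (\<forall>I. card I = r + 1 \<longrightarrow> affinely_independent_family p I)"

text \<open>
  Generating points whose affine span has dimension \<open>r\<close> are, up to an isometry, points of
  \<open>\<real>\<^sup>r\<close>. General position depends neither on the choice of generating points nor on the ambient
  space (\<open>EDM_general_position_iff\<close>), so taking them in \<open>\<real>\<^sup>n\<close> also covers the case \<open>r = 0\<close>.
\<close>

definition EDM_general_position :: "real ^ 'n ^ 'n \<Rightarrow> bool" where
  "EDM_general_position D \<longleftrightarrow>
     (\<exists>p :: 'n::finite \<Rightarrow> real ^ 'n. generating_points D p \<and> general_position (embedding_dim D) p)"

lemma EDM_general_position_iff:
  fixes p :: "'n::finite \<Rightarrow> 'a::euclidean_space"
  assumes D: "generating_points D p"
  shows "EDM_general_position D \<longleftrightarrow> general_position (embedding_dim D) p"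
proof -
  obtain q :: "'n \<Rightarrow> real ^ 'n" where q: "generating_points D q"
    using EDM_if_generating_points[OF D] by (auto simp: EDM_def)
  have "general_position r q' \<longleftrightarrow> general_position r p" if "generating_points D q'"
    for q' :: "'n \<Rightarrow> real ^ 'n" and r
    using affinely_independent_family_generating_points[OF that D]
    by (simp add: general_position_def)
  then show ?thesis using q by (auto simp: EDM_general_position_def)
qed

definition E_matrix :: "'n \<Rightarrow> 'n \<Rightarrow> real ^ 'n ^ 'n" where
  "E_matrix i j = (\<chi> a b. if (a = i \<and> b = j) \<or> (a = j \<and> b = i) then 1 else 0)"

definition yielding_interval :: "real ^ 'n ^ 'n \<Rightarrow> 'n::finite \<Rightarrow> 'n \<Rightarrow> real \<Rightarrow> real \<Rightarrow> bool" where
  "yielding_interval D i j l u \<longleftrightarrow>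
     l \<le> 0 \<and> 0 \<le> u \<and> (\<forall>t. EDM (D + t *\<^sub>R E_matrix i j) \<longleftrightarrow> l \<le> t \<and> t \<le> u)"

definition unyielding :: "real ^ 'n ^ 'n \<Rightarrow> 'n::finite \<Rightarrow> 'n \<Rightarrow> bool" where
  "unyielding D i j \<longleftrightarrow> (\<exists>l u. yielding_interval D i j l u \<and> l = 0 \<and> u = 0)"

text \<open>
  Joint (un)yieldingness is only a notion for pairs of unyielding entries, so both predicates
  include that requirement.
\<close>

definition jointly_yielding :: "real ^ 'n ^ 'n \<Rightarrow> 'n::finite \<Rightarrow> 'n \<Rightarrow> 'n \<Rightarrow> bool" where
  "jointly_yielding D i j k \<longleftrightarrow> unyielding D i j \<and> unyielding D i k \<and>
     (\<exists>t\<^sub>1 t\<^sub>2. t\<^sub>1 \<noteq> 0 \<and> t\<^sub>2 \<noteq> 0 \<and> EDM (D + t\<^sub>1 *\<^sub>R E_matrix i j + t\<^sub>2 *\<^sub>R E_matrix i k))"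

definition jointly_unyielding :: "real ^ 'n ^ 'n \<Rightarrow> 'n::finite \<Rightarrow> 'n \<Rightarrow> 'n \<Rightarrow> bool" where
  "jointly_unyielding D i j k \<longleftrightarrow> unyielding D i j \<and> unyielding D i k \<and> \<not> jointly_yielding D i j k"

end

theory Submission
  imports Defs
begin

text \<open>
  Call \<open>c\<close> an affine relation of the generating points \<open>p\<close> if \<open>sum c UNIV = 0\<close> and
  \<open>(\<Sum>l\<in>UNIV. c l *\<^sub>R p l) = 0\<close> (a vector of the Gale space of \<open>D\<close>). The quadratic form
  of an EDM is nonpositive on all \<open>c\<close> with \<open>sum c UNIV = 0\<close>, and the form of \<open>D\<close> itself vanishes
  on its affine relations. So if \<open>D\<close> stays an EDM after \<open>t\<^sub>1\<close> is added to the entry \<open>i, j\<close> and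
  \<open>t\<^sub>2\<close> to the entry \<open>i, k\<close>, then \<open>c i * (t\<^sub>1 * c j + t\<^sub>2 * c k) \<le> 0\<close> for every affine
  relation \<open>c\<close>.

  Since \<open>n - 3 \<ge> r + 1\<close>, there are \<open>r + 1\<close> indices other than \<open>i, j, k\<close>. In general position
  their points span all of the affine hull affinely, so the point of each remaining index is an
  affine combination of them, and an affine relation can be given arbitrary values at \<open>i, j, k\<close>
  (\<open>affine_relation_extends\<close>). The values \<open>1, t\<^sub>1, t\<^sub>2\<close> turn the inequality into
  \<open>t\<^sub>1\<^sup>2 + t\<^sub>2\<^sup>2 \<le> 0\<close>, which leaves only the trivial perturbation. The
  case \<open>t\<^sub>2 = 0\<close> says that single entries are unyielding.
\<close>

lemma EDM_quadratic_form_nonpos: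
  fixes M :: "real ^ 'n ^ 'n" and c :: "'n::finite \<Rightarrow> real"
  assumes "EDM M" and "sum c UNIV = 0"
  shows "(\<Sum>a\<in>UNIV. \<Sum>b\<in>UNIV. c a * c b * M $ a $ b) \<le> 0"
proof -
  obtain q :: "'n \<Rightarrow> real ^ 'n" where "generating_points M q"
    using assms(1) by (auto simp: EDM_def)
  from norm_lincomb_generating_points[OF this finite assms(2)]
  have "- (\<Sum>a\<in>UNIV. \<Sum>b\<in>UNIV. c a * c b * M $ a $ b) / 2 \<ge> 0"
    by (metis zero_le_power2)
  then show ?thesis by simp
qed

lemma E_matrix_quadratic_form:
  fixes c :: "'n::finite \<Rightarrow> real"
  assumes "i \<noteq> j"
  shows "(\<Sum>a\<in>UNIV. \<Sum>b\<in>UNIV. c a * c b * E_matrix i j $ a $ b) = 2 * c i * c j"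
proof -
  have "c a * c b * E_matrix i j $ a $ b =
      (if b = j then if a = i then c i * c j else 0 else 0) +
      (if b = i then if a = j then c i * c j else 0 else 0)" for a b
    using assms by (auto simp: E_matrix_def)
  then show ?thesis
    by (simp add: sum.distrib)
qed

text \<open>
  An affinely independent family of \<open>r + 1\<close> points spans an affine space of dimension \<open>r\<close>, which
  leaves no room outside it in an affine hull of the same dimension.
\<close>

lemma range_subset_affine_hull_subfamily:
  fixes p :: "'n::finite \<Rightarrow> 'a::euclidean_space"
  assumes "affinely_independent_family p I" and "card I = r + 1" and "aff_dim (range p) = int r"
  shows "range p \<subseteq> affine hull (p ` I)"
proof -
  have "inj_on p I" and "\<not> affine_dependent (p ` I)"
    using assms(1) by (auto simp: affinely_independent_family_def)
  then have "aff_dim (p ` I) = int r"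
    using assms(2) by (simp add: affine_independent_iff_card card_image)
  moreover have "I \<noteq> {}" using assms(2) by auto
  ultimately have "affine hull (p ` I) = affine hull (range p)"
    using assms(3) by (intro affine_dim_equal) (simp_all add: hull_mono image_mono)
  then show ?thesis using hull_subset[of "range p" affine] by simp
qed

text \<open>
  If \<open>p m = (\<Sum>l\<in>I. A m l *\<^sub>R p l)\<close> with \<open>sum (A m) I = 1\<close>, then \<open>m\<close> carries the affine relation
  that is \<open>1\<close> at \<open>m\<close>, \<open>- A m l\<close> at each \<open>l \<in> I\<close> and \<open>0\<close> elsewhere. The relation sought is the
  combination of these with weights \<open>v m\<close>.
\<close>

lemma affine_relation_extends:
  fixes p :: "'n::finite \<Rightarrow> 'a::euclidean_space" and v :: "'n \<Rightarrow> real"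
  assumes inj: "inj_on p I" and span: "range p \<subseteq> affine hull (p ` I)"
  obtains c where "\<And>m. m \<notin> I \<Longrightarrow> c m = v m"
    and "sum c UNIV = 0" and "(\<Sum>l\<in>UNIV. c l *\<^sub>R p l) = 0"
proof -
  have "\<exists>a. sum a I = 1 \<and> (\<Sum>l\<in>I. a l *\<^sub>R p l) = p m" for m
  proof -
    have "p m \<in> affine hull (p ` I)" using span by auto
    then obtain u where "sum u (p ` I) = 1" "(\<Sum>x\<in>p ` I. u x *\<^sub>R x) = p m"
      by (auto simp: affine_hull_finite)
    then show ?thesis
      by (intro exI[of _ "u \<circ> p"]) (simp add: sum.reindex[OF inj])
  qed
  then obtain A where A: "\<And>m. sum (A m) I = 1" "\<And>m. (\<Sum>l\<in>I. A m l *\<^sub>R p l) = p m"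
    by metis
  define c where "c l = (if l \<in> I then - (\<Sum>m\<in>-I. v m * A m l) else v l)" for l
  have split: "sum f UNIV = sum f I + sum f (-I)" for f :: "'n \<Rightarrow> 'b::comm_monoid_add"
    using sum.union_disjoint[of I "-I" f] by (simp add: Compl_partition)
  have "sum c I = - (\<Sum>l\<in>I. \<Sum>m\<in>-I. v m * A m l)"
    by (simp add: c_def sum_negf)
  also have "(\<Sum>l\<in>I. \<Sum>m\<in>-I. v m * A m l) = (\<Sum>m\<in>-I. v m * sum (A m) I)"
    by (subst sum.swap) (simp add: sum_distrib_left)
  finally have "sum c I = - sum v (-I)" by (simp add: A)
  moreover have "sum c (-I) = sum v (-I)"
    by (rule sum.cong) (auto simp: c_def)
  ultimately have "sum c UNIV = 0" by (simp add: split)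
  moreover have "(\<Sum>l\<in>UNIV. c l *\<^sub>R p l) = 0"
  proof -
    have "(\<Sum>l\<in>I. c l *\<^sub>R p l) = - (\<Sum>l\<in>I. \<Sum>m\<in>-I. v m *\<^sub>R A m l *\<^sub>R p l)"
      by (simp add: c_def sum_negf scaleR_sum_left)
    also have "(\<Sum>l\<in>I. \<Sum>m\<in>-I. v m *\<^sub>R A m l *\<^sub>R p l) = (\<Sum>m\<in>-I. v m *\<^sub>R (\<Sum>l\<in>I. A m l *\<^sub>R p l))"
      by (subst sum.swap) (simp add: scaleR_sum_right)
    finally have "(\<Sum>l\<in>I. c l *\<^sub>R p l) = - (\<Sum>m\<in>-I. v m *\<^sub>R p m)" by (simp add: A)
    moreover have "(\<Sum>l\<in>-I. c l *\<^sub>R p l) = (\<Sum>m\<in>-I. v m *\<^sub>R p m)"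
      by (rule sum.cong) (auto simp: c_def)
    ultimately show ?thesis by (simp add: split)
  qed
  moreover have "c m = v m" if "m \<notin> I" for m using that by (simp add: c_def)
  ultimately show thesis using that by blast
qed

lemma EDM_perturbation_trivial:
  fixes D :: "real ^ 'n ^ 'n"
  assumes D: "EDM D" and r: "embedding_dim D + 4 \<le> CARD('n::finite)"
    and gp: "EDM_general_position D"
    and ijk: "i \<noteq> j" "i \<noteq> k" "j \<noteq> k"
    and M: "EDM (D + t\<^sub>1 *\<^sub>R E_matrix i j + t\<^sub>2 *\<^sub>R E_matrix i k)"
  shows "t\<^sub>1 = 0 \<and> t\<^sub>2 = 0"
proof -
  obtain p :: "'n \<Rightarrow> real ^ 'n" where p: "generating_points D p"
    using D by (auto simp: EDM_def)
  have "embedding_dim D + 1 \<le> card (- {i, j, k})"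
    using r ijk by (simp add: Compl_eq_Diff_UNIV card_Diff_subset)
  then obtain I where I: "I \<subseteq> - {i, j, k}" "card I = embedding_dim D + 1"
    by (rule obtain_subset_with_card_n)
  have ind: "affinely_independent_family p I"
    using gp I(2) by (simp add: EDM_general_position_iff[OF p] general_position_def)
  have span: "range p \<subseteq> affine hull (p ` I)"
    using range_subset_affine_hull_subfamily[OF ind I(2)] embedding_dim_eq[OF p] by simp
  have inj: "inj_on p I" using ind by (simp add: affinely_independent_family_def)
  obtain c where c: "\<And>m. m \<notin> I \<Longrightarrow> c m = (if m = i then 1 else if m = j then t\<^sub>1 else t\<^sub>2)"
    and c0: "sum c UNIV = 0" and cp: "(\<Sum>l\<in>UNIV. c l *\<^sub>R p l) = 0"
    using affine_relation_extends[OF inj span,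
        of "\<lambda>m. if m = i then 1 else if m = j then t\<^sub>1 else t\<^sub>2"] by blast
  have cv: "c i = 1" "c j = t\<^sub>1" "c k = t\<^sub>2"
    using c[of i] c[of j] c[of k] I(1) ijk by auto
  have form_D: "(\<Sum>a\<in>UNIV. \<Sum>b\<in>UNIV. c a * c b * D $ a $ b) = 0"
    using norm_lincomb_generating_points[OF p finite c0] cp by simp
  have "(\<Sum>a\<in>UNIV. \<Sum>b\<in>UNIV. c a * c b * (D + t\<^sub>1 *\<^sub>R E_matrix i j + t\<^sub>2 *\<^sub>R E_matrix i k) $ a $ b)
     = (\<Sum>a\<in>UNIV. \<Sum>b\<in>UNIV. c a * c b * D $ a $ b)
       + t\<^sub>1 * (\<Sum>a\<in>UNIV. \<Sum>b\<in>UNIV. c a * c b * E_matrix i j $ a $ b)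
       + t\<^sub>2 * (\<Sum>a\<in>UNIV. \<Sum>b\<in>UNIV. c a * c b * E_matrix i k $ a $ b)"
    by (simp add: sum.distrib sum_distrib_left algebra_simps)
  also have "\<dots> = 2 * (t\<^sub>1\<^sup>2 + t\<^sub>2\<^sup>2)"
    by (simp add: form_D E_matrix_quadratic_form ijk cv power2_eq_square)
  finally have "t\<^sub>1\<^sup>2 + t\<^sub>2\<^sup>2 \<le> 0"
    using EDM_quadratic_form_nonpos[OF M c0] by simp
  then show ?thesis by (simp add: sum_power2_le_zero_iff)
qed

theorem corollary5p2:
  fixes D :: "real ^ 'n ^ 'n" and r :: nat
  assumes "EDM D"
    and "embedding_dim D = r"
    and "r + 4 \<le> CARD('n)"
    and "EDM_general_position D"
  shows "(\<forall>i j. i \<noteq> j \<longrightarrow> unyielding D i j) \<and>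
    (\<forall>i j k. i \<noteq> j \<and> i \<noteq> k \<and> j \<noteq> k \<longrightarrow> jointly_unyielding D i j k)"
proof -
  have r: "embedding_dim D + 4 \<le> CARD('n)" using assms by simp
  note trivial = EDM_perturbation_trivial[OF assms(1) r assms(4)]
  have single: "unyielding D i j" if "i \<noteq> j" for i j
  proof -
    have "card {i, j} < CARD('n)" using r that by simp
    then have "{i, j} \<noteq> UNIV" by (metis less_irrefl)
    then obtain k where k: "k \<noteq> i" "k \<noteq> j" by auto
    have "t = 0" if "EDM (D + t *\<^sub>R E_matrix i j)" for t
      using trivial[of i j k t 0] that \<open>i \<noteq> j\<close> k by auto
    then have "EDM (D + t *\<^sub>R E_matrix i j) \<longleftrightarrow> 0 \<le> t \<and> t \<le> 0" for t
      using assms(1) by (metis order_antisym order_refl add.right_neutral scaleR_zero_left)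
    then show ?thesis unfolding unyielding_def yielding_interval_def by blast
  qed
  moreover have "jointly_unyielding D i j k" if "i \<noteq> j" "i \<noteq> k" "j \<noteq> k" for i j k
    unfolding jointly_unyielding_def jointly_yielding_def
    using trivial[OF that] single that by blast
  ultimately show ?thesis by blast
qed

end
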